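(* Let $0<\alpha<1$. The FBDF2 method, i.e. the convolution quadrature with weights $\varpi_k$ given by $\left(\frac32-2\xi+\frac12\xi^2\right)^{\alpha}=\sum_{k\ge0}\varpi_k\xi^k$ for the fractional derivative of order $\alpha$, is convergent of second order.
   Context: For a function $f$ on $[0,\infty)$, a step $h>0$ and $x=nh$, the convolution quadrature for the Riemann–Liouville derivative ${}_0^{RL}D^\alpha$ is $$(D_h^\alpha f)(x)=h^{-\alpha}\sum_{j=0}^{n}\varpi_{n-j}f(jh).$$ Convergence is understood in the sense of Lubich's discretized fractional calculus: the quadrature is convergent of order $p$ if for every $\beta\in\mathbb C\setminus\{0,-1,-2,\dots\}$, with $f(t)=t^{\beta-1}$ (with $f(0)$ taken to be $0$ whenever $t^{\beta-1}$ has no limit at $0$), $$(D_h^\alpha f)(1)-\frac{\Gamma(\beta)}{\Gamma(\beta-\alpha)}=O(h^\beta)+O(h^p)\qquad\text{as } h=1/n\to0,$$ where $\frac{\Gamma(\beta)}{\Gamma(\beta-\alpha)}$ is the value at $t=1$ of the (analytically continued in $\beta$) fractional derivative of order $\alpha$ of $t^{\beta-1}$, $1/\Gamma$ being zero at the poles of $\Gamma$, and $O(h^\beta)$ means $O(h^{\operatorname{Re}\beta})$. *)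

theory Defs
  imports "HOL-Complex_Analysis.Complex_Analysis" "HOL-Library.Landau_Symbols"
begin

text \<open>Convolution quadrature with step \<open>h\<close> and weights \<open>w\<close>, evaluated at the grid point \<open>x = n * h\<close>.\<close>

definition conv_quadrature ::
    "real \<Rightarrow> (nat \<Rightarrow> complex) \<Rightarrow> real \<Rightarrow> (real \<Rightarrow> complex) \<Rightarrow> nat \<Rightarrow> complex" where
  "conv_quadrature \<alpha> w h f n =
     of_real (h powr (-\<alpha>)) * (\<Sum>j=0..n. w (n - j) * f (real j * h))"

text \<open>
  The function \<open>t \<mapsto> t\<^sup>\<beta>\<^sup>-\<^sup>1\<close> on \<open>[0, \<infinity>)\<close>. The value at \<open>0\<close> is treated separately because
  \<open>0 powr 0 = 0\<close>, whereas the limit at \<open>0\<close> is \<open>1\<close> for \<open>\<beta> = 1\<close>.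
\<close>

definition power_fun :: "complex \<Rightarrow> real \<Rightarrow> complex" where
  "power_fun \<beta> t =
     (if t = 0 then
        (if \<exists>L. ((\<lambda>s. of_real s powr (\<beta> - 1)) \<longlongrightarrow> L) (at_right (0::real))
         then Lim (at_right (0::real)) (\<lambda>s. of_real s powr (\<beta> - 1))
         else 0)
      else of_real t powr (\<beta> - 1))"

text \<open>
  The error at \<open>x = 1\<close> for \<open>h = 1/n\<close> is required to be in \<open>O(h powr Re \<beta>) + O(h ^ p)\<close>.
  The entire function \<open>rGamma\<close> is \<open>1/\<Gamma>\<close>, with value \<open>0\<close> at the poles of \<open>\<Gamma>\<close>.
\<close>

definition convergent_of_order :: "real \<Rightarrow> (nat \<Rightarrow> complex) \<Rightarrow> nat \<Rightarrow> bool" where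
  "convergent_of_order \<alpha> w p \<longleftrightarrow>
     (\<forall>\<beta>::complex. \<beta> \<notin> \<int>\<^sub>\<le>\<^sub>0 \<longrightarrow>
       (\<exists>u v :: nat \<Rightarrow> complex.
          u \<in> O[sequentially](\<lambda>n. of_real ((1 / real n) powr Re \<beta>)) \<and>
          v \<in> O[sequentially](\<lambda>n. of_real ((1 / real n) ^ p)) \<and>
          (\<forall>\<^sub>F n in sequentially.
             conv_quadrature \<alpha> w (1 / real n) (power_fun \<beta>) n
               - Gamma \<beta> * rGamma (\<beta> - of_real \<alpha>) = u n + v n)))"

text \<open>
  On the open unit disc, \<open>3/2 - 2 * \<xi> + \<xi>\<^sup>2/2 = (1 - \<xi>) * (3 - \<xi>) / 2\<close> avoids the branch cut of
  the principal power, so this is the branch taking the real value \<open>(3/2) powr \<alpha>\<close> at \<open>0\<close>.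
\<close>

definition fbdf2_gen :: "real \<Rightarrow> complex \<Rightarrow> complex" where
  "fbdf2_gen \<alpha> \<xi> = (3/2 - 2 * \<xi> + 1/2 * \<xi>^2) powr of_real \<alpha>"

definition fbdf2_weight :: "real \<Rightarrow> nat \<Rightarrow> complex" where
  "fbdf2_weight \<alpha> k = fps_nth (fps_expansion (fbdf2_gen \<alpha>) 0) k"

lemma fbdf2_gen_has_fps_expansion: "fbdf2_gen \<alpha> has_fps_expansion Abs_fps (fbdf2_weight \<alpha>)"
proof -
  have "fbdf2_gen \<alpha> analytic_on {0}"
    unfolding fbdf2_gen_def by (auto intro!: analytic_intros simp: complex_nonpos_Reals_iff)
  then show ?thesis
    using analytic_at_imp_has_fps_expansion_0 by (simp add: fbdf2_weight_def[abs_def] fps_nth_inverse)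
qed

end

theory Submission
  imports Defs "HOL-Real_Asymp.Real_Asymp"
begin

text \<open>
  Write \<open>B b\<close> for the power series of \<open>(1 - \<xi>) powr (-b)\<close>, whose coefficients are
  \<open>pochhammer b n / n! = O(n powr (Re b - 1))\<close>. Up to \<open>O(n powr (Re b - 4))\<close>, the sequence
  \<open>rGamma b * n powr (b - 1)\<close> has the generating function
  \<open>B b - b/2 * B (b - 1) + b * (3*b - 5)/24 * B (b - 2)\<close>, for every complex \<open>b\<close>. Expanding
  \<open>((3 - \<xi>)/2) powr \<alpha>\<close> at \<open>\<xi> = 1\<close>, the weights have the generating function
  \<open>B (-\<alpha>) * (1 + \<alpha>/2 * (1 - \<xi>) + (1 - \<xi>)\<^sup>2 * k \<xi>)\<close> with \<open>k\<close> holomorphic in \<open>|\<xi>| < 3\<close>. In the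
  product of the two the coefficient of \<open>B (\<beta> - \<alpha> - 1)\<close> is \<open>-(\<beta> - \<alpha>)/2\<close>, which is again the one of
  the expansion of \<open>n powr (\<beta> - \<alpha> - 1)\<close>: the first-order errors cancel. What remains is
  \<open>O(n powr (Re \<beta> - \<alpha> - 3))\<close>, and the convolution of the weights, which are
  \<open>O(n powr (-\<alpha> - 1))\<close>, with a sequence \<open>O(n powr (Re \<beta> - 4))\<close>.
\<close>

section \<open>Sequences of polynomial growth\<close>

text \<open>The shift to \<open>Suc n\<close> keeps the bound positive at index \<open>0\<close>,
  where \<open>0 powr t = 0\<close>. One constant then serves all \<open>n\<close>, and convolution
  sums can be bounded termwise.\<close>

definition growth :: "real \<Rightarrow> (nat \<Rightarrow> complex) \<Rightarrow> bool" where
  "growth t x \<longleftrightarrow> (\<exists>C. \<forall>n. norm (x n) \<le> C * real (Suc n) powr t)"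

lemma growthE:
  assumes "growth t x"
  obtains C where "C \<ge> 0" "\<And>n. norm (x n) \<le> C * real (Suc n) powr t"
proof -
  obtain C where C: "\<And>n. norm (x n) \<le> C * real (Suc n) powr t"
    using assms by (auto simp: growth_def)
  have "0 \<le> C"
    using order_trans[OF norm_ge_zero C[of 0]] by simp
  then show ?thesis using C by (rule that)
qed

lemma growth_iff_bigo: "growth t x \<longleftrightarrow> (\<lambda>n. norm (x n)) \<in> O(\<lambda>n. real n powr t)"
proof
  assume "growth t x"
  then obtain C where C: "\<And>n. norm (x n) \<le> C * real (Suc n) powr t"
    by (rule growthE) blast
  have "(\<lambda>n. norm (x n)) \<in> O(\<lambda>n. real (Suc n) powr t)"
    by (intro bigoI[of _ C] always_eventually) (use C in auto)
  also have "(\<lambda>n. real (Suc n) powr t) \<in> O(\<lambda>n. real n powr t)"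
    by real_asymp
  finally show "(\<lambda>n. norm (x n)) \<in> O(\<lambda>n. real n powr t)" .
next
  assume "(\<lambda>n. norm (x n)) \<in> O(\<lambda>n. real n powr t)"
  also have "(\<lambda>n. real n powr t) \<in> O(\<lambda>n. real (Suc n) powr t)"
    by real_asymp
  finally obtain C where C: "\<forall>\<^sub>F n in sequentially. norm (x n) \<le> C * real (Suc n) powr t"
    by (elim landau_o.bigE) auto
  then obtain N where N: "\<And>n. n \<ge> N \<Longrightarrow> norm (x n) \<le> C * real (Suc n) powr t"
    by (auto simp: eventually_at_top_linorder)
  define D where "D = max C (Max ((\<lambda>n. norm (x n) / real (Suc n) powr t) ` {..N}))"
  have "norm (x n) \<le> D * real (Suc n) powr t" for n
  proof (cases "n \<ge> N")
    case True
    have "C * real (Suc n) powr t \<le> D * real (Suc n) powr t"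
      by (intro mult_right_mono) (auto simp: D_def)
    with N[OF True] show ?thesis by linarith
  next
    case False
    have "norm (x n) / real (Suc n) powr t \<le> D"
      using False by (auto simp: D_def le_max_iff_disj intro!: disjI2 Max_ge)
    then show ?thesis by (simp add: divide_le_eq)
  qed
  then show "growth t x" by (auto simp: growth_def)
qed

lemma growth_mono:
  assumes "growth s x" "s \<le> t"
  shows "growth t x"
proof -
  have "(\<lambda>n. real n powr s) \<in> O(\<lambda>n. real n powr t)"
    using assms(2) by (intro bigoI[of _ 1] eventually_mono[OF eventually_gt_at_top[of 0]])
      (auto intro!: powr_mono)
  with assms(1) show ?thesis
    unfolding growth_iff_bigo by (rule landau_o.big_trans)
qed

lemma growth_add:
  assumes "growth t x" "growth t y"
  shows "growth t (\<lambda>n. x n + y n)"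
proof -
  obtain C D where "\<And>n. norm (x n) \<le> C * real (Suc n) powr t"
    "\<And>n. norm (y n) \<le> D * real (Suc n) powr t"
    using assms by (elim growthE) blast
  then have "norm (x n + y n) \<le> (C + D) * real (Suc n) powr t" for n
    by (metis add_mono distrib_right norm_triangle_le)
  then show ?thesis by (auto simp: growth_def)
qed

lemma growth_mult:
  assumes "growth s x" "growth t y"
  shows "growth (s + t) (\<lambda>n. x n * y n)"
  using landau_o.big.mult[OF assms[unfolded growth_iff_bigo]]
  by (simp add: growth_iff_bigo norm_mult powr_add)

lemma growth_cmult:
  assumes "growth t x"
  shows "growth t (\<lambda>n. c * x n)"
proof -
  have "growth 0 (\<lambda>_. c)"
    by (auto simp: growth_def)
  from growth_mult[OF this assms] show ?thesis by simp
qed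

lemma growth_diff:
  assumes "growth t x" "growth t y"
  shows "growth t (\<lambda>n. x n - y n)"
  using growth_add[OF assms(1) growth_cmult[OF assms(2), of "-1"]] by simp

lemma growth_eventually_cong:
  assumes "\<forall>\<^sub>F n in sequentially. x n = y n"
  shows "growth t x \<longleftrightarrow> growth t y"
  unfolding growth_iff_bigo
  by (rule landau_o.big.in_cong) (use assms in \<open>auto elim!: eventually_mono\<close>)

section \<open>Convolution of sequences of polynomial growth\<close>

lemma summable_Suc_powr: "s > 1 \<Longrightarrow> summable (\<lambda>n. real (Suc n) powr (-s))"
  using summable_Suc_iff[of "\<lambda>n. real n powr (-s)"] by (simp add: summable_real_powr_iff)

text \<open>With \<open>K\<close>, \<open>J\<close>, \<open>N\<close> as in the proof,
  \<open>N \<le> K + J\<close>, so \<open>J\<close> or \<open>K\<close> is at least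
  \<open>N / 2\<close>. In the first case \<open>J powr t\<close> is comparable to
  \<open>N powr t\<close>, in the second \<open>K powr (-s)\<close> is at most a multiple of
  \<open>N powr (-s)\<close>.\<close>

lemma Suc_powr_mult_le:
  assumes "s \<ge> 0" "-s \<le> t" "k \<le> n"
  shows "real (Suc k) powr (-s) * real (Suc (n - k)) powr t \<le>
    2 powr (\<bar>t\<bar> + s) * real (Suc n) powr t *
      (real (Suc k) powr (-s) + real (Suc (n - k)) powr (-s))"
proof -
  define K J N where "K = real (Suc k)" and "J = real (Suc (n - k))" and "N = real (Suc n)"
  have pos: "K > 0" "J > 0" "N > 0" and le: "K \<le> N" "J \<le> N" and sum: "N \<le> K + J"
    using assms(3) by (auto simp: K_def J_def N_def)
  show ?thesis
    unfolding K_def[symmetric] J_def[symmetric] N_def[symmetric]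
  proof (cases "N \<le> 2 * J")
    case True
    have "J powr t \<le> 2 powr \<bar>t\<bar> * N powr t"
    proof (cases "t \<ge> 0")
      case True
      have "J powr t \<le> N powr t" using pos le True by (intro powr_mono2) auto
      also have "\<dots> \<le> 2 powr \<bar>t\<bar> * N powr t"
        using ge_one_powr_ge_zero[of 2 "\<bar>t\<bar>"] by (simp add: mult_le_cancel_right1)
      finally show ?thesis .
    next
      case False
      have "J powr t \<le> (N / 2) powr t"
        using pos True False by (intro powr_mono2') auto
      also have "\<dots> = 2 powr \<bar>t\<bar> * N powr t"
        using False pos by (simp add: powr_divide powr_minus field_simps)
      finally show ?thesis .
    qed
    also have "\<dots> \<le> 2 powr (\<bar>t\<bar> + s) * N powr t"
      using assms by (intro mult_right_mono powr_mono) auto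
    finally have "K powr (-s) * J powr t \<le> K powr (-s) * (2 powr (\<bar>t\<bar> + s) * N powr t)"
      by (intro mult_left_mono) auto
    also have "\<dots> \<le> 2 powr (\<bar>t\<bar> + s) * N powr t * (K powr (-s) + J powr (-s))"
      by (simp add: algebra_simps)
    finally show "K powr (-s) * J powr t \<le> 2 powr (\<bar>t\<bar> + s) * N powr t * (K powr (-s) + J powr (-s))" .
  next
    case False
    then have "N \<le> 2 * K" using sum by linarith
    then have "K powr (-s) \<le> (N / 2) powr (-s)"
      using pos assms by (intro powr_mono2') auto
    also have "\<dots> = 2 powr s * N powr (-s)"
      using pos by (simp add: powr_divide powr_minus field_simps)
    also have "\<dots> \<le> 2 powr (\<bar>t\<bar> + s) * N powr (-s)"
      by (intro mult_right_mono powr_mono) auto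
    finally have "K powr (-s) * J powr t \<le> 2 powr (\<bar>t\<bar> + s) * N powr (-s) * J powr t"
      by (intro mult_right_mono) auto
    \<comment> \<open>As \<open>s + t \<ge> 0\<close>, the split-off factor can be raised to
      \<open>N powr (s + t)\<close>, which turns \<open>N powr (-s)\<close> into
      \<open>N powr t\<close>.\<close>
    also have "\<dots> = 2 powr (\<bar>t\<bar> + s) * N powr (-s) * (J powr (s + t) * J powr (-s))"
      by (simp add: powr_add[symmetric])
    also have "2 powr (\<bar>t\<bar> + s) * N powr (-s) * (J powr (s + t) * J powr (-s)) \<le>
      2 powr (\<bar>t\<bar> + s) * N powr (-s) * (N powr (s + t) * J powr (-s))"
      using pos le assms by (intro mult_left_mono mult_right_mono powr_mono2) auto
    also have "\<dots> = 2 powr (\<bar>t\<bar> + s) * (N powr (-s) * N powr (s + t)) * J powr (-s)"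
      by (simp only: mult_ac)
    also have "N powr (-s) * N powr (s + t) = N powr t"
      by (simp add: powr_add[symmetric])
    also have "2 powr (\<bar>t\<bar> + s) * N powr t * J powr (-s) \<le>
      2 powr (\<bar>t\<bar> + s) * N powr t * (K powr (-s) + J powr (-s))"
      by (intro mult_left_mono) auto
    finally show "K powr (-s) * J powr t \<le> 2 powr (\<bar>t\<bar> + s) * N powr t * (K powr (-s) + J powr (-s))" .
  qed
qed

text \<open>Summing \<open>Suc_powr_mult_le\<close> over \<open>k\<close> leaves
  \<open>real (Suc n) powr t\<close> times two partial sums, one of them reversed, of a series that
  converges for \<open>s > 1\<close>.\<close>

lemma growth_fps_mult:
  assumes "growth (-s) (fps_nth F)" "growth t (fps_nth G)" "s > 1" "-s \<le> t"
  shows "growth t (fps_nth (F * G))"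
proof -
  obtain C D where C: "C \<ge> 0" "\<And>n. norm (fps_nth F n) \<le> C * real (Suc n) powr (-s)"
    and D: "D \<ge> 0" "\<And>n. norm (fps_nth G n) \<le> D * real (Suc n) powr t"
    using assms by (elim growthE) blast
  define S where "S = (\<Sum>n. real (Suc n) powr (-s))"
  have S: "(\<Sum>k\<le>n. real (Suc k) powr (-s)) \<le> S" for n
    unfolding S_def using summable_Suc_powr[OF assms(3)] by (intro sum_le_suminf) auto
  have S': "(\<Sum>k\<le>n. real (Suc (n - k)) powr (-s)) \<le> S" for n
    using S[of n] by (subst sum.nat_diff_reindex[symmetric, of _ "Suc n", unfolded lessThan_Suc_atMost]) simp
  define E where "E = C * D * 2 powr (\<bar>t\<bar> + s)"
  have "norm (fps_nth (F * G) n) \<le> E * (2 * S) * real (Suc n) powr t" for n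
  proof -
    have "norm (fps_nth (F * G) n) \<le> (\<Sum>k\<le>n. norm (fps_nth F k) * norm (fps_nth G (n - k)))"
      unfolding fps_mult_nth atLeast0AtMost by (simp add: sum_norm_le norm_mult)
    also have "\<dots> \<le> (\<Sum>k\<le>n. (C * real (Suc k) powr (-s)) * (D * real (Suc (n - k)) powr t))"
      by (intro sum_mono mult_mono C D) (auto simp: C)
    also have "\<dots> = (\<Sum>k\<le>n. C * D * (real (Suc k) powr (-s) * real (Suc (n - k)) powr t))"
      by (simp only: mult_ac)
    also have "\<dots> \<le> (\<Sum>k\<le>n. C * D * (2 powr (\<bar>t\<bar> + s) * real (Suc n) powr t *
      (real (Suc k) powr (-s) + real (Suc (n - k)) powr (-s))))"
      using assms C D by (intro sum_mono mult_left_mono Suc_powr_mult_le) auto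
    also have "\<dots> = E * real (Suc n) powr t *
      ((\<Sum>k\<le>n. real (Suc k) powr (-s)) + (\<Sum>k\<le>n. real (Suc (n - k)) powr (-s)))"
      by (simp only: E_def sum_distrib_left sum.distrib[symmetric] mult.assoc)
    also have "\<dots> \<le> E * real (Suc n) powr t * (S + S)"
      using C D by (intro mult_left_mono add_mono S S') (auto simp: E_def)
    finally show ?thesis by (simp add: mult_ac)
  qed
  then show ?thesis by (auto simp: growth_def)
qed

lemma growth_fps_mult_max:
  assumes "growth (-s) (fps_nth F)" "growth t (fps_nth G)" "s > 1"
  shows "growth (max t (-s)) (fps_nth (F * G))"
proof -
  have "growth (max t (-s)) (fps_nth G)"
    by (rule growth_mono[OF assms(2)]) simp
  with assms show ?thesis by (intro growth_fps_mult[of s]) auto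
qed

section \<open>Binomial series with complex exponent\<close>

definition neg_binom_fps :: "complex \<Rightarrow> complex fps" where
  "neg_binom_fps b = Abs_fps (\<lambda>n. pochhammer b n / fact n)"

lemma neg_binom_fps_nth [simp]: "fps_nth (neg_binom_fps b) n = pochhammer b n / fact n"
  by (simp add: neg_binom_fps_def)

text \<open>The exponent law for \<open>(1 - \<xi>) powr (-b)\<close>; on coefficients it is the
  Chu-Vandermonde identity.\<close>

lemma neg_binom_fps_add: "neg_binom_fps (a + b) = neg_binom_fps a * neg_binom_fps b"
proof (rule fps_ext)
  fix n
  have "pochhammer (a + b) n / fact n =
    (\<Sum>k\<le>n. pochhammer a k / fact k * (pochhammer b (n - k) / fact (n - k)))"
    unfolding pochhammer_binomial_sum sum_divide_distrib
    by (intro sum.cong) (auto simp: binomial_fact)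
  then show "fps_nth (neg_binom_fps (a + b)) n = fps_nth (neg_binom_fps a * neg_binom_fps b) n"
    by (simp add: fps_mult_nth atLeast0AtMost)
qed

lemma neg_binom_fps_minus_1: "neg_binom_fps (-1) = 1 - fps_X"
proof (rule fps_ext)
  fix n
  have "pochhammer (-1 :: complex) (Suc (Suc k)) = 0" for k
    using pochhammer_of_nat_eq_0_lemma[of 1 "Suc (Suc k)", where 'a = complex] by simp
  then show "fps_nth (neg_binom_fps (-1)) n = fps_nth (1 - fps_X) n"
    by (cases n; cases "n - 1") (auto simp: fps_X_def)
qed

text \<open>A limit formula for the Gamma function in terms of binomial coefficients. With
  \<open>rGamma\<close> it also covers the poles of \<open>Gamma\<close>, where the limit is
  \<open>0\<close>.\<close>

lemma neg_binom_asymp: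
  "(\<lambda>n. pochhammer b n / fact n * of_nat n powr (1 - b)) \<longlonglongrightarrow> rGamma b"
  for b :: complex
proof -
  have "(\<lambda>n. ((b - 1 + of_nat n) gchoose n) * exp (- (b - 1) * of_real (ln (of_nat n)))) \<longlonglongrightarrow> rGamma (b - 1 + 1)"
    by (rule Gamma_gbinomial)
  also have "(\<lambda>n. (b - 1 + of_nat n) gchoose n) = (\<lambda>n. pochhammer b n / fact n)"
    by (simp add: gbinomial_pochhammer')
  finally have "(\<lambda>n. pochhammer b n / fact n * exp (- (b - 1) * of_real (ln (of_nat n)))) \<longlonglongrightarrow> rGamma b"
    by simp
  then show ?thesis
  proof (rule Lim_transform_eventually)
    show "\<forall>\<^sub>F n in sequentially. pochhammer b n / fact n * exp (- (b - 1) * of_real (ln (of_nat n))) =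
      pochhammer b n / fact n * of_nat n powr (1 - b)"
      using eventually_gt_at_top[of 0]
      by eventually_elim (auto simp: powr_def Ln_of_nat)
  qed
qed

lemma growth_of_nat_powr: "growth (Re z) (\<lambda>n. of_nat n powr z)"
  unfolding growth_iff_bigo
  by (intro bigoI[of _ 1] eventually_mono[OF eventually_gt_at_top[of 0]]) (auto simp: norm_powr_real_powr)

lemma growth_bounded_powr:
  assumes "growth s (\<lambda>n. x n * of_nat n powr z)"
  shows "growth (s - Re z) x"
proof -
  have "growth (s - Re z) (\<lambda>n. x n * of_nat n powr z * of_nat n powr (-z))"
    using growth_mult[OF assms growth_of_nat_powr[of "-z"]] by simp
  moreover have "\<forall>\<^sub>F n in sequentially. x n * of_nat n powr z * of_nat n powr (-z) = x n"
    using eventually_gt_at_top[of 0] by eventually_elim (auto simp: powr_minus)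
  ultimately show ?thesis by (subst (asm) growth_eventually_cong)
qed

lemma growth_imp_tendsto_0:
  assumes "growth t x" "t < 0"
  shows "x \<longlonglongrightarrow> 0"
proof -
  obtain C where C: "\<And>n. norm (x n) \<le> C * real (Suc n) powr t"
    using assms(1) by (rule growthE) blast
  have "(\<lambda>n. real (Suc n) powr t) \<longlonglongrightarrow> 0"
    using assms(2) by real_asymp
  then have "(\<lambda>n. C * real (Suc n) powr t) \<longlonglongrightarrow> 0"
    by (rule tendsto_mult_right_zero)
  then show ?thesis
    by (rule Lim_null_comparison[rotated]) (use C in auto)
qed

lemma growth_convergent:
  assumes "x \<longlonglongrightarrow> L"
  shows "growth 0 x"
proof -
  have "Bseq x" using assms by (intro convergent_imp_Bseq convergentI)
  then obtain C where "\<And>n. norm (x n) \<le> C" by (auto simp: Bseq_def)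
  then show ?thesis by (auto simp: growth_def)
qed

lemma growth_neg_binom: "growth (Re b - 1) (fps_nth (neg_binom_fps b))"
proof -
  have "fps_nth (neg_binom_fps b) = (\<lambda>n. pochhammer b n / fact n)" by auto
  then show ?thesis
    using growth_bounded_powr[OF growth_convergent[OF neg_binom_asymp[of b]]] by simp
qed

section \<open>Expansion of \<open>n powr (b - 1)\<close> into binomial coefficients\<close>

text \<open>The distance from \<open>g n\<close> to \<open>L\<close> is the sum of all later
  increments. Comparing inverse fourth powers with differences of consecutive inverse cubes makes
  the bounds telescope.\<close>

lemma growth_telescope:
  assumes "growth (-4) (\<lambda>n. g (Suc n) - g n)" "g \<longlonglongrightarrow> L"
  shows "growth (-3) (\<lambda>n. g n - L)"
proof -
  obtain C where C: "C \<ge> 0" "\<And>n. norm (g (Suc n) - g n) \<le> C * real (Suc n) powr (-4)"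
    using assms(1) by (rule growthE) blast
  have step: "norm (g (Suc n) - g n) \<le> C * (1 / real n ^ 3 - 1 / real (Suc n) ^ 3)" if "n > 0" for n
  proof -
    have "real n ^ 3 * (1 * real (Suc n) ^ 3) \<le> (real (Suc n) ^ 3 - real n ^ 3) * real (Suc n) ^ 4"
    proof -
      have "0 \<le> (real (Suc n) ^ 3 - real n ^ 3) * real (Suc n) - real n ^ 3"
        by (simp add: algebra_simps power_numeral_reduce)
      then have "0 \<le> ((real (Suc n) ^ 3 - real n ^ 3) * real (Suc n) - real n ^ 3) * real (Suc n) ^ 3"
        by (intro mult_nonneg_nonneg) auto
      then show ?thesis by (simp add: algebra_simps power_numeral_reduce)
    qed
    then have "1 / real (Suc n) ^ 4 \<le> 1 / real n ^ 3 - 1 / real (Suc n) ^ 3"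
      using that by (simp add: divide_simps mult_ac del: of_nat_Suc)
    moreover have "real (Suc n) powr (-4) = 1 / real (Suc n) ^ 4"
      by (simp add: powr_minus divide_inverse del: of_nat_Suc)
    ultimately show ?thesis
      using C(1) C(2)[of n] by (metis mult_left_mono order_trans)
  qed
  have diff: "norm (g (n + m) - g n) \<le> C * (1 / real n ^ 3 - 1 / real (n + m) ^ 3)" if "n > 0" for n m
  proof (induction m)
    case (Suc m)
    have "norm (g (n + Suc m) - g n) \<le> norm (g (Suc (n + m)) - g (n + m)) + norm (g (n + m) - g n)"
      using norm_triangle_ineq[of "g (Suc (n + m)) - g (n + m)" "g (n + m) - g n"] by simp
    also have "\<dots> \<le> C * (1 / real (n + m) ^ 3 - 1 / real (Suc (n + m)) ^ 3)
        + C * (1 / real n ^ 3 - 1 / real (n + m) ^ 3)"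
      using that by (intro add_mono Suc step) auto
    finally show ?case by (simp add: algebra_simps)
  qed auto
  have "norm (g n - L) \<le> C * real n powr (-3)" if "n > 0" for n
  proof -
    have "(\<lambda>m. norm (g (m + n) - g n)) \<longlonglongrightarrow> norm (L - g n)"
      by (intro tendsto_intros LIMSEQ_ignore_initial_segment assms)
    moreover have "norm (g (m + n) - g n) \<le> C * (1 / real n ^ 3)" for m
    proof -
      have "C * (1 / real n ^ 3 - 1 / real (n + m) ^ 3) \<le> C * (1 / real n ^ 3)"
        using C by (intro mult_left_mono) auto
      with diff[OF that, of m] show ?thesis by (simp add: add.commute)
    qed
    ultimately have "norm (L - g n) \<le> C * (1 / real n ^ 3)"
      by (intro tendsto_upperbound[of _ _ sequentially]) auto
    then show ?thesis
      using that by (simp add: norm_minus_commute powr_minus divide_inverse)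
  qed
  then show ?thesis
    unfolding growth_iff_bigo
    by (intro bigoI[of _ C] eventually_mono[OF eventually_gt_at_top[of 0]]) auto
qed

text \<open>
  The coefficients come from
  \<open>(-ln (1 - y)) powr (-b) = y powr (-b) * (1 - b/2 * y + b * (3*b - 5)/24 * y\<^sup>2 + \<dots>)\<close>
  with \<open>y = 1 - \<xi>\<close>.
\<close>
definition power_fps :: "complex \<Rightarrow> complex fps" where
  "power_fps b = neg_binom_fps b - fps_const (b / 2) * neg_binom_fps (b - 1)
     + fps_const (b * (3 * b - 5) / 24) * neg_binom_fps (b - 2)"

text \<open>The numerator left when the three binomial coefficients in \<open>power_fps b\<close>
  are brought over the denominator \<open>(b + j - 1) * (b + j - 2)\<close> and
  \<open>pochhammer b j / fact j\<close> is factored out.\<close>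

definition power_num :: "complex \<Rightarrow> complex \<Rightarrow> complex" where
  "power_num b j = (b + j - 1) * (b + j - 2) - b / 2 * (b - 1) * (b + j - 2)
     + b * (3 * b - 5) / 24 * (b - 1) * (b - 2)"

lemma pochhammer_minus_1: "(b + of_nat j - 1) * pochhammer (b - 1) j = (b - 1) * pochhammer b j"
  for b :: complex
  using pochhammer_rec[of "b - 1" j] pochhammer_rec'[of "b - 1" j] by (simp add: algebra_simps)

lemma power_fps_nth:
  "(b + of_nat j - 1) * (b + of_nat j - 2) * fps_nth (power_fps b) j =
     pochhammer b j / fact j * power_num b (of_nat j)"
proof -
  have 1: "(b + of_nat j - 1) * (pochhammer (b - 1) j / fact j) = (b - 1) * (pochhammer b j / fact j)"
    using pochhammer_minus_1[of b j] by (simp add: field_simps)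
  have 2: "(b + of_nat j - 2) * (pochhammer (b - 2) j / fact j) = (b - 2) * (pochhammer (b - 1) j / fact j)"
    using pochhammer_minus_1[of "b - 1" j] by (simp add: field_simps)
  show ?thesis
    unfolding power_fps_def power_num_def fps_add_nth fps_sub_nth fps_mult_left_const_nth neg_binom_fps_nth
    using 1 2 by algebra
qed

text \<open>The last factor \<open>b + of_nat j\<close> of \<open>pochhammer b (Suc j)\<close>
  cancels against a denominator. Consecutive coefficients are thus expressed through the same
  \<open>pochhammer b j / fact j\<close> and can be subtracted.\<close>

lemma power_fps_nth_Suc:
  assumes "b + of_nat j \<noteq> 0"
  shows "(b + of_nat j - 1) * of_nat (Suc j) * fps_nth (power_fps b) (Suc j) =
     pochhammer b j / fact j * power_num b (of_nat (Suc j))"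
proof -
  define P where "P = pochhammer b (Suc j) / fact (Suc j)"
  define Q where "Q = pochhammer b j / fact j"
  have PQ: "P * of_nat (Suc j) = (b + of_nat j) * Q"
    by (simp add: P_def Q_def pochhammer_rec' field_simps del: of_nat_Suc)
  have "(b + of_nat j) * (b + of_nat j - 1) * fps_nth (power_fps b) (Suc j) = P * power_num b (of_nat (Suc j))"
    using power_fps_nth[of b "Suc j"] by (simp add: P_def add_diff_eq)
  then have "(b + of_nat j) * ((b + of_nat j - 1) * of_nat (Suc j) * fps_nth (power_fps b) (Suc j)) =
     (b + of_nat j) * (Q * power_num b (of_nat (Suc j)))"
    using PQ by algebra
  then show ?thesis
    unfolding Q_def[symmetric] using assms mult_left_cancel by blast
qed

text \<open>The tail contains the factor \<open>z ^ m\<close>; the remaining series is dominated by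
  its value at \<open>1/2\<close>, which converges absolutely because the binomial series converges
  at \<open>3/4\<close>.\<close>

lemma gbinomial_series_remainder:
  fixes a :: complex
  obtains C where "\<And>z. norm z \<le> 1/2 \<Longrightarrow>
    norm ((1 + z) powr a - (\<Sum>k<m. (a gchoose k) * z ^ k)) \<le> C * norm z ^ m"
proof
  define C where "C = (\<Sum>n. norm ((a gchoose (n + m)) * (1/2) ^ n))"
  have "summable (\<lambda>n. (a gchoose n) * (3/4) ^ n)"
    using gen_binomial_complex[of "3/4" a] by (simp add: sums_iff)
  then have "summable (\<lambda>n. norm ((a gchoose n) * (1/2) ^ n))"
    by (rule powser_insidea) auto
  then have "summable (\<lambda>n. norm ((a gchoose (n + m)) * (1/2) ^ (n + m)))"
    by (subst summable_iff_shift)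
  then have "summable (\<lambda>n. 2 ^ m * norm ((a gchoose (n + m)) * (1/2) ^ (n + m)))"
    by (rule summable_mult)
  then have C: "summable (\<lambda>n. norm ((a gchoose (n + m)) * (1/2) ^ n))"
    by (simp add: norm_mult norm_power norm_divide power_add field_simps)
  fix z :: complex
  assume z: "norm z \<le> 1/2"
  have "(\<lambda>n. (a gchoose n) * z ^ n) sums (1 + z) powr a"
    using z by (intro gen_binomial_complex) auto
  then have "(\<lambda>n. (a gchoose (n + m)) * z ^ (n + m)) sums
      ((1 + z) powr a - (\<Sum>k<m. (a gchoose k) * z ^ k))"
    by (rule sums_split_initial_segment)
  then have *: "(1 + z) powr a - (\<Sum>k<m. (a gchoose k) * z ^ k) =
      (\<Sum>n. (a gchoose (n + m)) * z ^ (n + m))"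
    by (simp add: sums_iff)
  have le: "norm ((a gchoose (n + m)) * z ^ (n + m)) \<le>
      norm z ^ m * norm ((a gchoose (n + m)) * (1/2) ^ n)" for n
  proof -
    have "norm z ^ n \<le> (1/2) ^ n"
      using z by (intro power_mono) auto
    then have "norm z ^ m * norm (a gchoose (n + m)) * norm z ^ n \<le>
        norm z ^ m * norm (a gchoose (n + m)) * (1/2) ^ n"
      by (intro mult_left_mono) auto
    then show ?thesis by (simp add: norm_mult norm_power norm_divide power_add mult_ac)
  qed
  have "norm (\<Sum>n. (a gchoose (n + m)) * z ^ (n + m)) \<le>
      (\<Sum>n. norm z ^ m * norm ((a gchoose (n + m)) * (1/2) ^ n))"
    using le C by (intro norm_suminf_le summable_mult) auto
  then show "norm ((1 + z) powr a - (\<Sum>k<m. (a gchoose k) * z ^ k)) \<le> C * norm z ^ m"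
    using suminf_mult[OF C, of "norm z ^ m"] by (simp add: * C_def mult.commute)
qed

text \<open>
  The polynomials of \<open>power_fps\<close> are chosen so that in the quotient of consecutive terms of
  \<open>power_fps b\<close> and of \<open>n powr (b - 1)\<close> everything up to relative order \<open>j\<^sup>-\<^sup>3\<close> cancels.
\<close>
lemma power_num_identity:
  fixes b :: complex
  obtains q0 q1 q2 where "\<And>j. j \<noteq> 0 \<Longrightarrow>
    (b + j - 2) * power_num b (j + 1) * (\<Sum>k<4. ((-b) gchoose k) * (1 / j) ^ k) / j - power_num b j =
    (q0 + q1 / j + q2 / j\<^sup>2) / j\<^sup>2"
proof
  \<comment> \<open>The \<open>t\<close> are binomial coefficients of
    \<open>(1 + 1/j) powr (-b)\<close>; the \<open>p\<close> and the \<open>m\<close> are the lower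
    coefficients of the monic polynomials \<open>power_num b j\<close> and
    \<open>(b + j - 2) * power_num b (j + 1)\<close> in \<open>j\<close>.\<close>
  define t1 t2 t3 where "t1 = -b" and "t2 = b * (b + 1) / 2" and "t3 = - b * (b + 1) * (b + 2) / 6"
  define p1 p0 where "p1 = 2 * b - 3 - b * (b - 1) / 2"
    and "p0 = (b - 1) * (b - 2) * (1 - b / 2 + b * (3 * b - 5) / 24)"
  define m1 m2 m3 where "m1 = p1 + b" and "m2 = 1 + p1 + p0 + (b - 2) * (p1 + 2)"
    and "m3 = (b - 2) * (1 + p1 + p0)"
  note defs = t1_def t2_def t3_def p1_def p0_def m1_def m2_def m3_def
  fix j :: complex
  assume j: "j \<noteq> 0"
  have T: "(\<Sum>k<4. ((-b) gchoose k) * (1 / j) ^ k) = 1 + t1 / j + t2 / j^2 + t3 / j^3"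
    by (simp add: eval_nat_numeral gbinomial_pochhammer pochhammer_Suc t1_def t2_def t3_def)
      (simp add: field_simps)
  have N: "power_num b j = j^2 + p1 * j + p0"
    by (simp add: power_num_def defs field_simps power2_eq_square)
  have M: "(b + j - 2) * power_num b (j + 1) = j^3 + m1 * j^2 + m2 * j + m3"
  proof -
    have "power_num b (j + 1) = j^2 + (p1 + 2) * j + (1 + p1 + p0)"
      by (simp add: power_num_def defs field_simps power2_eq_square)
    then show ?thesis
      by (simp add: m1_def m2_def m3_def algebra_simps power2_eq_square power3_eq_cube)
  qed
  \<comment> \<open>These are the coefficients of \<open>j^5\<close>, \<open>j^4\<close> and
    \<open>j^3\<close> below. The first vanishes for every \<open>p1\<close>, the other two by the
    choice of \<open>b / 2\<close> and \<open>b * (3 * b - 5) / 24\<close> in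
    \<open>power_fps\<close>. A polynomial of degree at most 2 over \<open>j^4\<close> is
    left.\<close>
  have c: "t1 + m1 - p1 = 0" "t2 + t1 * m1 + m2 - p0 = 0" "t3 + t2 * m1 + t1 * m2 + m3 = 0"
    by (simp_all add: defs field_simps)
  have "(j^3 + m1 * j^2 + m2 * j + m3) * (j^3 + t1 * j^2 + t2 * j + t3) - j^4 * (j^2 + p1 * j + p0) =
     (t1 + m1 - p1) * j^5 + (t2 + t1 * m1 + m2 - p0) * j^4 + (t3 + t2 * m1 + t1 * m2 + m3) * j^3 +
     ((t3 * m1 + t2 * m2 + t1 * m3) * j^2 + (t3 * m2 + t2 * m3) * j + t3 * m3)"
    by algebra
  then have "(j^3 + m1 * j^2 + m2 * j + m3) * (j^3 + t1 * j^2 + t2 * j + t3) / j^4 - (j^2 + p1 * j + p0) =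
     ((t3 * m1 + t2 * m2 + t1 * m3) * j^2 + (t3 * m2 + t2 * m3) * j + t3 * m3) / j^4"
    using j unfolding c by (simp add: field_simps)
  also have "(j^3 + m1 * j^2 + m2 * j + m3) * (j^3 + t1 * j^2 + t2 * j + t3) / j^4 =
     (j^3 + m1 * j^2 + m2 * j + m3) * (1 + t1 / j + t2 / j^2 + t3 / j^3) / j"
    using j by (simp add: divide_simps power_numeral_reduce) (simp add: algebra_simps)
  also have "((t3 * m1 + t2 * m2 + t1 * m3) * j^2 + (t3 * m2 + t2 * m3) * j + t3 * m3) / j^4 =
     ((t3 * m1 + t2 * m2 + t1 * m3) + (t3 * m2 + t2 * m3) / j + t3 * m3 / j^2) / j^2"
    using j by (simp add: divide_simps power_numeral_reduce) (simp add: algebra_simps)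
  finally show "(b + j - 2) * power_num b (j + 1) * (\<Sum>k<4. ((-b) gchoose k) * (1 / j) ^ k) / j
      - power_num b j =
     ((t3 * m1 + t2 * m2 + t1 * m3) + (t3 * m2 + t2 * m3) / j + t3 * m3 / j^2) / j^2"
    unfolding T N M .
qed

lemma growth_of_nat_add: "growth 1 (\<lambda>n. of_nat n + c)"
proof -
  have "growth 1 of_nat"
    by (auto simp: growth_def intro!: exI[of _ 1])
  moreover have "growth 1 (\<lambda>_. c)"
    by (rule growth_mono[of 0]) (auto simp: growth_def)
  ultimately show ?thesis by (rule growth_add)
qed

text \<open>Eventually the denominator is at least \<open>n / 2\<close> in norm; the finitely many
  smaller \<open>n\<close>, where it may vanish, do not affect the growth.\<close>

lemma growth_inverse_of_nat_add: "growth (-1) (\<lambda>n. inverse (of_nat n + c))"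
proof -
  have "\<forall>\<^sub>F n in sequentially. real n \<ge> 2 * norm c + 1"
    by real_asymp
  then have "\<forall>\<^sub>F n in sequentially. norm (inverse (of_nat n + c)) \<le> 2 * real n powr (-1)"
  proof eventually_elim
    case (elim n)
    then have n: "real n > 0" by (smt (verit) norm_ge_zero)
    have "real n / 2 \<le> norm (of_nat n + c)"
      using norm_diff_ineq[of "of_nat n" c] elim by simp
    then have "inverse (norm (of_nat n + c)) \<le> inverse (real n / 2)"
      using n by (intro le_imp_inverse_le) auto
    with n show ?case by (simp add: norm_inverse powr_minus_divide)
  qed
  then show ?thesis
    unfolding growth_iff_bigo by (intro bigoI[of _ 2]) auto
qed

text \<open>Divided by \<open>n powr (b - 1)\<close>, the coefficients form a sequence
  \<open>g\<close> with limit \<open>rGamma b\<close> and increments of order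
  \<open>n powr (-4)\<close>, so \<open>growth_telescope\<close> applies. Increments, unlike
  quotients of consecutive terms, also handle nonpositive integers \<open>b\<close>, where
  \<open>pochhammer b n\<close> is eventually \<open>0\<close>.\<close>

lemma growth_power_fps:
  "growth (Re b - 4) (\<lambda>n. fps_nth (power_fps b) n - rGamma b * of_nat n powr (b - 1))"
proof -
  define g where "g n = fps_nth (power_fps b) n * of_nat n powr (1 - b)" for n
  define A where "A n = pochhammer b n / fact n * of_nat n powr (1 - b)" for n
  define T where "T z = (\<Sum>k<4. ((-b) gchoose k) * z ^ k)" for z
  define R where "R n = (1 + 1 / of_nat n) powr (-b) - T (1 / of_nat n)" for n :: nat
  \<comment> \<open>\<open>A n * E n\<close> will be
    \<open>(b + n - 1) * (b + n - 2) * (g (Suc n) - g n)\<close>. The first summand pairs the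
    remainder \<open>R\<close>, of order \<open>n powr (-4)\<close>, with a factor of order
    \<open>n powr 2\<close>; the second is the expression in \<open>power_num_identity\<close>. Both
    are of order \<open>n powr (-2)\<close>.\<close>
  define E where "E n = (b + of_nat n - 2) * power_num b (of_nat n + 1) * inverse (of_nat n) * R n +
     ((b + of_nat n - 2) * power_num b (of_nat n + 1) * T (1 / of_nat n) / of_nat n - power_num b (of_nat n))" for n :: nat
  have A: "A \<longlonglongrightarrow> rGamma b"
    unfolding A_def by (rule neg_binom_asymp)
  have lin: "growth 1 (\<lambda>n. c + of_nat n)" "growth 1 (\<lambda>n. c + of_nat n - d)" "growth 1 (\<lambda>n. of_nat n + c - d)" for c d
    
  proof -
    have "c + of_nat n - d = of_nat n + (c - d)" "of_nat n + c - d = of_nat n + (c - d)" for n by simp_all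
    then show "growth 1 (\<lambda>n. c + of_nat n)" "growth 1 (\<lambda>n. c + of_nat n - d)" "growth 1 (\<lambda>n. of_nat n + c - d)"
      using growth_of_nat_add[of c] growth_of_nat_add[of "c - d"] by (simp_all only: add.commute[of c])
  qed
  have inv: "growth (-1) (\<lambda>n. inverse (c + of_nat n - d))" "growth (-1) (\<lambda>n. inverse (of_nat n))" for c d
  proof -
    have "c + of_nat n - d = of_nat n + (c - d)" for n by simp
    then show "growth (-1) (\<lambda>n. inverse (c + of_nat n - d))"
      using growth_inverse_of_nat_add[of "c - d"] by (simp only:)
    show "growth (-1) (\<lambda>n. inverse (of_nat n))"
      using growth_inverse_of_nat_add[of 0] by simp
  qed
  have const: "growth t (\<lambda>_. c)" if "t \<ge> 0" for t c
    using growth_mono[OF _ that, of "\<lambda>_. c"] by (auto simp: growth_def)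
  have R: "growth (-4) R"
  proof -
    obtain C where C: "\<And>z. norm z \<le> 1/2 \<Longrightarrow> norm ((1 + z) powr (-b) - T z) \<le> C * norm z ^ 4"
      unfolding T_def by (rule gbinomial_series_remainder[of "-b" 4]) blast
    have "\<forall>\<^sub>F n in sequentially. norm (R n) \<le> C * real n powr (-4)"
      using eventually_ge_at_top[of 2]
    proof eventually_elim
      case (elim n)
      then have "norm (R n) \<le> C * norm (1 / of_nat n :: complex) ^ 4"
        unfolding R_def by (intro C) (auto simp: norm_divide field_simps)
      with elim show ?case by (simp add: norm_divide powr_minus power_divide field_simps)
    qed
    then show ?thesis
      unfolding growth_iff_bigo by (intro bigoI[of _ C]) auto
  qed
  have num: "growth 2 (\<lambda>n. power_num b (of_nat n + 1))"
  proof -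
    have "growth (1 + 1) (\<lambda>n. (b + of_nat n) * (of_nat n + (b - 1)))"
      "growth 2 (\<lambda>n. b / 2 * (b - 1) * (b + of_nat n - 1))"
      by (intro growth_mult lin growth_of_nat_add growth_mono[OF growth_cmult[OF lin(2)]]; simp)+
    from growth_add[OF growth_diff[OF this[simplified]] const[of 2 "b * (3 * b - 5) / 24 * (b - 1) * (b - 2)"]]
    show ?thesis by (simp add: power_num_def algebra_simps)
  qed
  have E1: "growth (-2) (\<lambda>n. (b + of_nat n - 2) * power_num b (of_nat n + 1) * inverse (of_nat n) * R n)"
    using growth_mult[OF growth_mult[OF growth_mult[OF lin(2) num] inv(2)] R] by simp
  obtain q0 q1 q2 where q: "\<And>j. j \<noteq> 0 \<Longrightarrow>
    (b + j - 2) * power_num b (j + 1) * T (1 / j) / j - power_num b j =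
    (q0 + q1 / j + q2 / j\<^sup>2) / j\<^sup>2"
    unfolding T_def by (rule power_num_identity[of b]) blast
  have "growth 0 (\<lambda>n. q0 + q1 * inverse (of_nat n) + q2 * (inverse (of_nat n) * inverse (of_nat n)))"
    using inv(2) growth_mult[OF inv(2) inv(2)]
    by (intro growth_add const growth_cmult) (auto elim: growth_mono)
  from growth_mult[OF this growth_mult[OF inv(2) inv(2)]]
  have "growth (-2) (\<lambda>n. (q0 + q1 / of_nat n + q2 / (of_nat n)\<^sup>2) / (of_nat n)\<^sup>2)"
    by (simp add: divide_inverse power2_eq_square)
  moreover have "\<forall>\<^sub>F n in sequentially. (q0 + q1 / of_nat n + q2 / (of_nat n)\<^sup>2) / (of_nat n)\<^sup>2 =
    (b + of_nat n - 2) * power_num b (of_nat n + 1) * T (1 / of_nat n) / of_nat n - power_num b (of_nat n)"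
    using eventually_gt_at_top[of 0] by eventually_elim (simp add: q)
  ultimately have "growth (-2) (\<lambda>n. (b + of_nat n - 2) * power_num b (of_nat n + 1) * T (1 / of_nat n) / of_nat n - power_num b (of_nat n))"
    by (subst (asm) growth_eventually_cong)
  with E1 have E: "growth (-2) E"
    unfolding E_def by (rule growth_add)
  have "growth (-4) (\<lambda>n. A n * E n * (inverse (b + of_nat n - 1) * inverse (b + of_nat n - 2)))"
    using growth_mult[OF growth_mult[OF growth_convergent[OF A] E] growth_mult[OF inv(1) inv(1)]] by simp
  moreover have "\<forall>\<^sub>F n in sequentially. A n * E n * (inverse (b + of_nat n - 1) * inverse (b + of_nat n - 2)) = g (Suc n) - g n"
  proof -
    have "\<forall>\<^sub>F n in sequentially. real n > norm b + 2" by real_asymp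
    then show ?thesis
    proof eventually_elim
      case (elim n)
      have nz: "b + of_nat n - c \<noteq> 0" if "norm c \<le> 2" for c
      proof
        assume "b + of_nat n - c = 0"
        then have "of_nat n = c - b" by (simp add: algebra_simps)
        then have "real n = norm (c - b)" by (metis norm_of_nat)
        with elim that norm_triangle_ineq4[of c b] show False by simp
      qed
      have "real n > 0" using elim norm_ge_zero[of b] by linarith
      then have n: "real n > 0" "n \<noteq> 0" by auto
      define F where "F = (1 + 1 / of_nat n :: complex) powr (-b)"
      have "of_nat (Suc n) = of_nat n * (1 + 1 / of_nat n :: complex)"
        using n by (simp add: field_simps)
      then have "of_nat (Suc n) powr (-b) = (of_nat n * (1 + 1 / of_nat n)) powr (-b)"
        by (simp only:)
      also have "\<dots> = of_nat n powr (-b) * F"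
        unfolding F_def using n by (intro powr_times_real) (auto simp: complex_is_Real_iff Re_divide)
      finally have S: "of_nat (Suc n) powr (-b) = of_nat n powr (-b) * F" .
      have AP: "of_nat n powr (-b) = of_nat n powr (1 - b) / of_nat n"
        "of_nat (Suc n) powr (1 - b) = of_nat (Suc n) * of_nat (Suc n) powr (-b)"
        using n by (simp_all add: powr_diff powr_minus field_simps del: of_nat_Suc)
      have "(b + of_nat n - 1) * (b + of_nat n - 2) * g (Suc n) =
        (b + of_nat n - 2) * ((b + of_nat n - 1) * of_nat (Suc n) * fps_nth (power_fps b) (Suc n)) * of_nat (Suc n) powr (-b)"
        by (simp add: g_def AP(2) mult_ac del: of_nat_Suc)
      also have "\<dots> = (b + of_nat n - 2) * (pochhammer b n / fact n * power_num b (of_nat n + 1)) * (of_nat n powr (1 - b) / of_nat n * F)"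
        using power_fps_nth_Suc[of b n] nz[of 0] S AP(1) by (simp add: add.commute)
      also have "\<dots> = A n * ((b + of_nat n - 2) * power_num b (of_nat n + 1) * inverse (of_nat n) * F)"
        by (simp add: A_def field_simps)
      finally have 1: "(b + of_nat n - 1) * (b + of_nat n - 2) * g (Suc n) = A n * ((b + of_nat n - 2) * power_num b (of_nat n + 1) * inverse (of_nat n) * F)" .
      have 2: "(b + of_nat n - 1) * (b + of_nat n - 2) * g n = A n * power_num b (of_nat n)"
        unfolding g_def A_def mult.assoc[symmetric] power_fps_nth by (simp only: mult_ac)
      have "E n = (b + of_nat n - 2) * power_num b (of_nat n + 1) * inverse (of_nat n) * F - power_num b (of_nat n)"
        unfolding E_def R_def F_def[symmetric] by (simp add: algebra_simps divide_inverse)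
      then have "A n * E n = A n * ((b + of_nat n - 2) * power_num b (of_nat n + 1) * inverse (of_nat n) * F)
          - A n * power_num b (of_nat n)"
        by (simp only: right_diff_distrib)
      also have "\<dots> = (b + of_nat n - 1) * (b + of_nat n - 2) * (g (Suc n) - g n)"
        unfolding 1[symmetric] 2[symmetric] by (rule right_diff_distrib[symmetric])
      finally have AE: "A n * E n = (b + of_nat n - 1) * (b + of_nat n - 2) * (g (Suc n) - g n)" .
      have cancel: "x * y * z * (inverse x * inverse y) = z" if "x \<noteq> 0" "y \<noteq> 0" for x y z :: complex
        using that by (simp add: field_simps)
      show ?case
        unfolding AE using nz[of 1] nz[of 2] by (intro cancel) simp_all
    qed
  qed
  ultimately have D: "growth (-4) (\<lambda>n. g (Suc n) - g n)"
    by (subst (asm) growth_eventually_cong)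
  have "g \<longlonglongrightarrow> rGamma b"
  proof -
    \<comment> \<open>The corrections in \<open>power_fps b\<close> are smaller than
      \<open>n powr (b - 1)\<close> by the factors \<open>n powr (-1)\<close> and
      \<open>n powr (-2)\<close>, so only \<open>A\<close> contributes to the limit.\<close>
    have lim: "(\<lambda>n. c * (fps_nth (neg_binom_fps (b - of_real k)) n * of_nat n powr (1 - b))) \<longlonglongrightarrow> 0"
      if "k > 0" for c k
      using growth_cmult[OF growth_mult[OF growth_neg_binom[of "b - of_real k"] growth_of_nat_powr[of "1 - b"]], of c] that
      by (elim growth_imp_tendsto_0) auto
    have "(\<lambda>n. A n - b / 2 * (fps_nth (neg_binom_fps (b - of_real 1)) n * of_nat n powr (1 - b)) +
      b * (3 * b - 5) / 24 * (fps_nth (neg_binom_fps (b - of_real 2)) n * of_nat n powr (1 - b))) \<longlonglongrightarrow> rGamma b - 0 + 0"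
      by (intro tendsto_intros A lim) auto
    moreover have "g = (\<lambda>n. A n
        - b / 2 * (fps_nth (neg_binom_fps (b - of_real 1)) n * of_nat n powr (1 - b))
        + b * (3 * b - 5) / 24 * (fps_nth (neg_binom_fps (b - of_real 2)) n * of_nat n powr (1 - b)))"
      unfolding g_def[abs_def] A_def power_fps_def
      by (simp only: fps_add_nth fps_sub_nth fps_mult_left_const_nth neg_binom_fps_nth
          of_real_1 of_real_numeral distrib_right left_diff_distrib mult.assoc)
    ultimately show ?thesis by simp
  qed
  with D have "growth (-3) (\<lambda>n. g n - rGamma b)"
    by (rule growth_telescope)
  moreover have "\<forall>\<^sub>F n in sequentially. g n - rGamma b =
      (fps_nth (power_fps b) n - rGamma b * of_nat n powr (b - 1)) * of_nat n powr (1 - b)"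
    using eventually_gt_at_top[of 0]
    by eventually_elim (simp add: g_def algebra_simps powr_add[symmetric])
  ultimately have "growth (-3) (\<lambda>n. (fps_nth (power_fps b) n - rGamma b * of_nat n powr (b - 1)) * of_nat n powr (1 - b))"
    by (subst (asm) growth_eventually_cong)
  from growth_bounded_powr[OF this] show ?thesis by simp
qed

section \<open>Generating function of the FBDF2 weights\<close>

lemma neg_binom_has_fps_expansion: "(\<lambda>z. (1 - z) powr (-b)) has_fps_expansion neg_binom_fps b"
proof (rule has_fps_expansionI)
  have "(\<lambda>n. fps_nth (neg_binom_fps b) n * z ^ n) sums (1 - z) powr (-b)" if "norm z < 1" for z
  proof -
    have "(-b gchoose n) * (-z) ^ n = fps_nth (neg_binom_fps b) n * ((-1) ^ n * (-z) ^ n)" for n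
      by (simp add: gbinomial_pochhammer)
    then have "(-b gchoose n) * (-z) ^ n = fps_nth (neg_binom_fps b) n * z ^ n" for n
      by (simp flip: power_mult_distrib)
    with gen_binomial_complex[of "-z" "-b"] that show ?thesis by simp
  qed
  moreover have "\<forall>\<^sub>F z in nhds 0. norm (z :: complex) < 1"
    using eventually_nhds_in_open[of "ball 0 1" "0 :: complex"] by simp
  ultimately show "\<forall>\<^sub>F z in nhds 0. (\<lambda>n. fps_nth (neg_binom_fps b) n * z ^ n) sums (1 - z) powr (-b)"
    by (auto elim: eventually_mono)
qed

text \<open>Arguments in the right half-plane are below \<open>pi / 2\<close> in modulus, so their
  sum stays on the principal branch and \<open>Ln\<close> is additive.\<close>

lemma powr_mult_Re_pos:
  fixes w z :: complex
  assumes "Re w > 0" "Re z > 0"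
  shows "(w * z) powr a = w powr a * z powr a"
proof -
  have nz: "w \<noteq> 0" "z \<noteq> 0" using assms by auto
  then have "\<bar>Im (Ln w)\<bar> < pi / 2" "\<bar>Im (Ln z)\<bar> < pi / 2"
    using assms Re_Ln_pos_lt by blast+
  then have "Ln (w * z) = Ln w + Ln z"
    using nz by (intro Ln_times_simple) auto
  then show ?thesis
    using nz by (simp add: powr_def exp_add algebra_simps)
qed

text \<open>The difference quotient, completed at \<open>a\<close> by the derivative, has a
  removable singularity. Iterating gives a Taylor expansion whose remainder factor is holomorphic on
  all of \<open>S\<close>.\<close>

lemma holomorphic_factor_out:
  assumes "f holomorphic_on S" "a \<in> interior S"
  obtains g where "g holomorphic_on S" "g a = deriv f a" "\<And>z. f z = f a + (z - a) * g z"
proof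
  define g where "g z = (if z = a then deriv f a else (f z - f a) / (z - a))" for z
  show "g holomorphic_on S"
    using pole_lemma[OF assms] by (simp add: g_def[abs_def])
qed (auto simp: field_simps)

text \<open>The series converges at a radius \<open>s\<close> strictly between \<open>1\<close> and
  \<open>r\<close>, so the coefficients decay geometrically, hence faster than any power.\<close>

lemma growth_fps_expansion:
  assumes "f holomorphic_on ball 0 r" "r > 1"
  shows "growth t (fps_nth (fps_expansion f 0))"
proof -
  define s where "s = (1 + r) / 2"
  have s: "1 < s" "s < r" using assms by (auto simp: s_def)
  have "(\<lambda>n. (deriv ^^ n) f 0 / fact n * (of_real s - 0) ^ n) sums f (of_real s)"
    using s by (intro holomorphic_power_series[OF assms(1)]) auto
  then have "(\<lambda>n. fps_nth (fps_expansion f 0) n * of_real s ^ n) \<longlonglongrightarrow> 0"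
    by (auto simp: fps_expansion_def sums_iff intro: summable_LIMSEQ_zero)
  then have 1: "growth 0 (\<lambda>n. fps_nth (fps_expansion f 0) n * of_real s ^ n)"
    by (rule growth_convergent)
  have 2: "growth t (\<lambda>n. inverse (of_real s) ^ n)"
  proof -
    have "(\<lambda>n. q ^ n) \<in> O(\<lambda>n. real n powr t)" if "0 < q" "q < 1" for q :: real
      using that by real_asymp
    from this[of "inverse s"] have "(\<lambda>n. inverse s ^ n) \<in> O(\<lambda>n. real n powr t)"
      using s(1) by (simp add: inverse_less_1_iff)
    then show ?thesis
      using s(1) by (simp add: growth_iff_bigo norm_power norm_inverse)
  qed
  from growth_mult[OF 1 2] s(1) show ?thesis
    by (simp add: mult.assoc flip: power_mult_distrib)
qed

lemma fbdf2_fps: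
  obtains K where "\<And>t. growth t (fps_nth K)"
    "Abs_fps (fbdf2_weight \<alpha>) = neg_binom_fps (- of_real \<alpha>) *
       (1 + fps_const (of_real \<alpha> / 2) * neg_binom_fps (-1) + neg_binom_fps (-2) * K)"
proof -
  define f where "f z = ((3 - z) / 2) powr of_real \<alpha>" for z :: complex
  have Re: "Re z < 3" if "norm z < 3" for z
    using that complex_Re_le_cmod[of z] by simp
  have f: "f holomorphic_on ball 0 3"
    unfolding f_def by (auto intro!: holomorphic_intros simp: complex_nonpos_Reals_iff dest!: Re)
  have f1: "f 1 = 1" by (simp add: f_def)
  have "(f has_field_derivative - of_real \<alpha> / 2) (at 1)"
    unfolding f_def by (auto intro!: derivative_eq_intros)
  then have f': "deriv f 1 = - of_real \<alpha> / 2"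
    by (rule DERIV_imp_deriv)
  \<comment> \<open>Factoring twice at \<open>1\<close>, the singular point of the other factor
    \<open>(1 - z) powr \<alpha>\<close>, gives the second-order expansion of \<open>f\<close>
    there.\<close>
  obtain g where g: "g holomorphic_on ball 0 3" "g 1 = - of_real \<alpha> / 2" "\<And>z. f z = 1 + (z - 1) * g z"
    using holomorphic_factor_out[OF f, of 1] f1 f' by (auto simp: interior_open)
  obtain k where k: "k holomorphic_on ball 0 3" "\<And>z. g z = - of_real \<alpha> / 2 + (z - 1) * k z"
    using holomorphic_factor_out[OF g(1), of 1] g(2) by (auto simp: interior_open)
  define K where "K = fps_expansion k 0"
  have K: "k has_fps_expansion K"
    unfolding K_def using k(1)
    by (intro analytic_at_imp_has_fps_expansion_0) (auto simp: analytic_at intro: exI[of _ "ball 0 3"])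
  have nb: "neg_binom_fps (-2) = (1 - fps_X) * (1 - fps_X)"
    using neg_binom_fps_add[of "-1" "-1"] by (simp add: neg_binom_fps_minus_1)
  have "(\<lambda>z. (1 - z) powr - (- of_real \<alpha>) *
      (1 + of_real \<alpha> / 2 * (1 - z) + ((1 - z) * (1 - z)) * k z)) has_fps_expansion
      neg_binom_fps (- of_real \<alpha>) * (1 + fps_const (of_real \<alpha> / 2) * neg_binom_fps (-1) + neg_binom_fps (-2) * K)"
    unfolding nb neg_binom_fps_minus_1
    by (intro fps_expansion_intros neg_binom_has_fps_expansion K)
  moreover have "\<forall>\<^sub>F z in nhds 0. (1 - z) powr - (- of_real \<alpha>) *
      (1 + of_real \<alpha> / 2 * (1 - z) + ((1 - z) * (1 - z)) * k z) = fbdf2_gen \<alpha> z"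
  proof -
    have "\<forall>\<^sub>F z in nhds 0. norm (z :: complex) < 1"
      using eventually_nhds_in_open[of "ball 0 1" "0 :: complex"] by simp
    then show ?thesis
    proof eventually_elim
      case (elim z)
      \<comment> \<open>On the unit disc \<open>1 - z\<close> and \<open>(3 - z) / 2\<close> both
        have positive real part, so their principal powers multiply.\<close>
      then have "Re z < 1" using complex_Re_le_cmod[of z] by simp
      then have "((1 - z) * ((3 - z) / 2)) powr of_real \<alpha> = (1 - z) powr of_real \<alpha> * f z"
        unfolding f_def by (intro powr_mult_Re_pos) auto
      also have "(1 - z) * ((3 - z) / 2) = 3/2 - 2 * z + 1/2 * z^2"
        by (simp add: field_simps power2_eq_square)
      finally have "(1 - z) powr of_real \<alpha> * f z = fbdf2_gen \<alpha> z"
        by (simp only: fbdf2_gen_def)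
      moreover have "f z = 1 + of_real \<alpha> / 2 * (1 - z) + ((1 - z) * (1 - z)) * k z"
        unfolding g(3) k(2) by (simp add: field_simps)
      ultimately show ?case by (simp only: minus_minus)
    qed
  qed
  ultimately have "fbdf2_gen \<alpha> has_fps_expansion
      neg_binom_fps (- of_real \<alpha>) * (1 + fps_const (of_real \<alpha> / 2) * neg_binom_fps (-1) + neg_binom_fps (-2) * K)"
    by (subst (asm) has_fps_expansion_cong[OF _ refl])
  from fps_expansion_unique_complex[OF fbdf2_gen_has_fps_expansion this]
  show ?thesis
    using that[of K] growth_fps_expansion[OF k(1)] by (simp add: K_def)
qed

section \<open>Rapidly decaying factors and products with the weights\<close>

lemma growth_finite_support:
  assumes "\<And>n. n \<ge> N \<Longrightarrow> x n = 0"
  shows "growth t x"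
proof -
  have "\<forall>\<^sub>F n in sequentially. x n = 0"
    using assms by (auto simp: eventually_at_top_linorder)
  then have "growth t x \<longleftrightarrow> growth t (\<lambda>_. 0)"
    by (rule growth_eventually_cong)
  then show ?thesis by (auto simp: growth_def intro: exI[of _ 0])
qed

text \<open>Every rate is available for the factors, so \<open>s\<close> is taken large enough both
  for summability and for the rate \<open>t\<close>.\<close>

lemma rapid_fps_mult:
  assumes "\<And>t. growth t (fps_nth F)" "\<And>t. growth t (fps_nth G)"
  shows "growth t (fps_nth (F * G))"
proof -
  define s where "s = max 2 (-t)"
  have "growth (-s) (fps_nth (F * G))"
    by (rule growth_fps_mult[of s]) (auto simp: assms s_def)
  then show ?thesis by (rule growth_mono) (auto simp: s_def)
qed

lemma rapid_fps_const: "growth t (fps_nth (fps_const c))"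
  by (rule growth_finite_support[of 1]) auto

lemma rapid_neg_binom_minus_1: "growth t (fps_nth (neg_binom_fps (-1)))"
  by (rule growth_finite_support[of 2]) (auto simp: neg_binom_fps_minus_1 fps_X_def)

lemma rapid_fps_add:
  "growth t (fps_nth F) \<Longrightarrow> growth t (fps_nth G) \<Longrightarrow> growth t (fps_nth (F + G))"
  using growth_add[of t "fps_nth F" "fps_nth G"] by (simp add: growth_def)

text \<open>In powers of \<open>1 - \<xi>\<close>, the linear coefficients add up to
  \<open>\<alpha>/2 - b/2 = -(b - \<alpha>)/2\<close>, the one in
  \<open>power_fps (b - \<alpha>)\<close>: this is the gain of an order. The quadratic ones need not
  agree; their difference goes into \<open>K\<close>.\<close>

lemma fbdf2_mult_power_fps:
  obtains K where "\<And>t. growth t (fps_nth K)"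
    "Abs_fps (fbdf2_weight \<alpha>) * power_fps b =
       power_fps (b - of_real \<alpha>) + neg_binom_fps (b - of_real \<alpha> - 2) * K"
proof -
  obtain K where K: "\<And>t. growth t (fps_nth K)"
    and W: "Abs_fps (fbdf2_weight \<alpha>) = neg_binom_fps (- of_real \<alpha>) *
       (1 + fps_const (of_real \<alpha> / 2) * neg_binom_fps (-1) + neg_binom_fps (-2) * K)"
    by (rule fbdf2_fps) blast
  define Y where "Y = neg_binom_fps (-1)"
  define a c d where "a = fps_const (complex_of_real \<alpha> / 2)" and "c = fps_const (b / 2)"
    and "d = fps_const (b * (3 * b - 5) / 24)"
  define e where "e = fps_const ((b - of_real \<alpha>) * (3 * (b - of_real \<alpha>) - 5) / 24)"
  define D where "D = neg_binom_fps (b - of_real \<alpha>)"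
  \<comment> \<open>The excess of the product over \<open>power_fps (b - \<alpha>)\<close>, with
    \<open>D * (Y * Y)\<close> factored out. Writing differences with \<open>fps_const (-1)\<close>
    lets the closure rules for sums and products apply.\<close>
  define L where "L = K + (d + fps_const (-1) * (a * c) + fps_const (-1) * e) + a * d * Y
    + fps_const (-1) * (c * Y * K) + d * (Y * Y) * K"
  have Y: "neg_binom_fps (x - 1) = neg_binom_fps x * Y"
    "neg_binom_fps (x - 2) = neg_binom_fps x * (Y * Y)" "neg_binom_fps (-2) = Y * Y" for x
    using neg_binom_fps_add[of x "-1"] neg_binom_fps_add[of "x - 1" "-1"] neg_binom_fps_add[of "-1" "-1"]
    by (simp_all add: Y_def mult.assoc)
  have D: "neg_binom_fps (- of_real \<alpha>) * neg_binom_fps b = D"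
    using neg_binom_fps_add[of "- of_real \<alpha>" b] by (simp add: D_def)
  have ac: "fps_const ((b - of_real \<alpha>) / 2) = c - a"
    by (simp add: a_def c_def diff_divide_distrib flip: fps_const_sub)
  have m1: "fps_const (-1 :: complex) = -1"
    by (simp flip: fps_const_neg)
  have "Abs_fps (fbdf2_weight \<alpha>) * power_fps b =
      (neg_binom_fps (- of_real \<alpha>) * neg_binom_fps b) * ((1 + a * Y + Y * Y * K) * (1 - c * Y + d * (Y * Y)))"
    unfolding W power_fps_def Y Y_def[symmetric] a_def[symmetric] c_def[symmetric] d_def[symmetric] by algebra
  also have "\<dots> = (D - (c - a) * (D * Y) + e * (D * (Y * Y))) + D * (Y * Y) * L"
    unfolding D L_def m1 by algebra
  also have "\<dots> = power_fps (b - of_real \<alpha>) + neg_binom_fps (b - of_real \<alpha> - 2) * L"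
    unfolding power_fps_def Y ac D_def[symmetric] e_def[symmetric] ..
  finally have "Abs_fps (fbdf2_weight \<alpha>) * power_fps b = power_fps (b - of_real \<alpha>) + neg_binom_fps (b - of_real \<alpha> - 2) * L" .
  moreover have "growth t (fps_nth L)" for t
    unfolding L_def a_def c_def d_def e_def Y_def
    by (intro rapid_fps_add rapid_fps_mult rapid_fps_const rapid_neg_binom_minus_1 K)
  ultimately show ?thesis by (rule that[rotated])
qed

text \<open>The cofactor of \<open>(1 - \<xi>) powr \<alpha>\<close> has rapidly decaying
  coefficients, so the weights inherit the decay of the singular factor, which is summable for
  \<open>\<alpha> > 0\<close>.\<close>

lemma growth_fbdf2_weight:
  assumes "\<alpha> > 0"
  shows "growth (-1 - \<alpha>) (fbdf2_weight \<alpha>)"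
proof -
  obtain K where K: "\<And>t. growth t (fps_nth K)"
    and W: "Abs_fps (fbdf2_weight \<alpha>) = neg_binom_fps (- of_real \<alpha>) *
       (1 + fps_const (of_real \<alpha> / 2) * neg_binom_fps (-1) + neg_binom_fps (-2) * K)"
    by (rule fbdf2_fps) blast
  define H where "H = fps_const 1 + fps_const (of_real \<alpha> / 2) * neg_binom_fps (-1) + neg_binom_fps (-1) * neg_binom_fps (-1) * K"
  have "growth t (fps_nth H)" for t
    unfolding H_def
    by (intro rapid_fps_add rapid_fps_mult rapid_fps_const rapid_neg_binom_minus_1 K)
  moreover have "growth (-1 - \<alpha>) (fps_nth (neg_binom_fps (- of_real \<alpha>)))"
    using growth_neg_binom[of "- of_real \<alpha>"] by (rule growth_mono) simp
  ultimately have "growth (-1 - \<alpha>) (fps_nth (H * neg_binom_fps (- of_real \<alpha>)))"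
    using assms by (intro growth_fps_mult[of "1 + \<alpha>"]) auto
  also have "H * neg_binom_fps (- of_real \<alpha>) = Abs_fps (fbdf2_weight \<alpha>)"
    using neg_binom_fps_add[of "-1" "-1"] by (simp add: W H_def mult.commute)
  also have "fps_nth (Abs_fps (fbdf2_weight \<alpha>)) = fbdf2_weight \<alpha>"
    by auto
  finally show ?thesis .
qed

section \<open>Error of the quadrature for powers\<close>

lemma fbdf2_power_convolution:
  fixes b :: complex
  assumes "0 < \<alpha>" "\<alpha> < 1" "b \<notin> \<int>\<^sub>\<le>\<^sub>0"
  shows "growth (max (Re b - \<alpha> - 3) (-1 - \<alpha>))
    (\<lambda>n. (\<Sum>j=0..n. fbdf2_weight \<alpha> (n - j) * of_nat j powr (b - 1))
       - Gamma b * rGamma (b - of_real \<alpha>) * of_nat n powr (b - of_real \<alpha> - 1))"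
    (is "growth ?t _")
proof -
  define W where "W = Abs_fps (fbdf2_weight \<alpha>)"
  \<comment> \<open>As \<open>0 powr (b - 1) = 0\<close> for every \<open>b\<close>, the node
    \<open>j = 0\<close> is absent here; \<open>power_fun b 0\<close> enters only in
    \<open>fbdf2_error\<close>.\<close>
  define P where "P = Abs_fps (\<lambda>n. of_nat n powr (b - 1))"
  define R where "R = P - fps_const (Gamma b) * power_fps b"
  obtain K where K: "\<And>t. growth t (fps_nth K)"
    and WP: "W * power_fps b = power_fps (b - of_real \<alpha>) + neg_binom_fps (b - of_real \<alpha> - 2) * K"
    unfolding W_def by (rule fbdf2_mult_power_fps) blast
  have "growth (Re b - 4) (\<lambda>n. - Gamma b * (fps_nth (power_fps b) n - rGamma b * of_nat n powr (b - 1)))"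
    by (intro growth_cmult growth_power_fps)
  moreover have "(\<lambda>n. - Gamma b * (fps_nth (power_fps b) n - rGamma b * of_nat n powr (b - 1))) = fps_nth R"
    using Gamma_nonzero[OF assms(3)] by (auto simp: R_def P_def rGamma_inverse_Gamma field_simps)
  ultimately have "growth (Re b - 4) (fps_nth R)"
    by (simp only:)
  moreover have "growth (-(1 + \<alpha>)) (fps_nth W)"
  proof -
    have "fps_nth W = fbdf2_weight \<alpha>" by (auto simp: W_def)
    then show ?thesis using growth_fbdf2_weight[OF assms(1)] by simp
  qed
  ultimately have "growth (max (Re b - 4) (-(1 + \<alpha>))) (fps_nth (W * R))"
    using assms(1) by (intro growth_fps_mult_max) simp_all
  \<comment> \<open>\<open>Re b - 4\<close> lies below \<open>Re b - \<alpha> - 3\<close> because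
    \<open>\<alpha> < 1\<close>.\<close>
  then have 1: "growth ?t (fps_nth (W * R))"
    by (rule growth_mono) (use assms in auto)
  define t where "t = Re b - \<alpha> - 3"
  have "growth t (fps_nth (K * neg_binom_fps (b - of_real \<alpha> - 2)))"
    using growth_neg_binom[of "b - of_real \<alpha> - 2"]
    by (intro growth_fps_mult[of "max 2 (-t)"] K) (auto simp: t_def algebra_simps)
  then have "growth t (\<lambda>n. Gamma b * fps_nth (K * neg_binom_fps (b - of_real \<alpha> - 2)) n)"
    by (rule growth_cmult)
  then have 2: "growth ?t (\<lambda>n. Gamma b * fps_nth (K * neg_binom_fps (b - of_real \<alpha> - 2)) n)"
    by (rule growth_mono) (auto simp: t_def)
  have "growth (Re (b - of_real \<alpha>) - 4) (\<lambda>n. Gamma b * (fps_nth (power_fps (b - of_real \<alpha>)) n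
      - rGamma (b - of_real \<alpha>) * of_nat n powr (b - of_real \<alpha> - 1)))"
    by (intro growth_cmult growth_power_fps)
  then have 3: "growth ?t (\<lambda>n. Gamma b * (fps_nth (power_fps (b - of_real \<alpha>)) n
      - rGamma (b - of_real \<alpha>) * of_nat n powr (b - of_real \<alpha> - 1)))"
    by (rule growth_mono) auto
  have "P = fps_const (Gamma b) * power_fps b + R"
    by (simp add: R_def)
  then have "P * W = fps_const (Gamma b) * (W * power_fps b) + W * R"
    by (simp add: algebra_simps)
  then have "P * W = fps_const (Gamma b) * power_fps (b - of_real \<alpha>)
      + fps_const (Gamma b) * (K * neg_binom_fps (b - of_real \<alpha> - 2)) + W * R"
    by (simp add: WP algebra_simps)
  then have "fps_nth (P * W) n = Gamma b * fps_nth (power_fps (b - of_real \<alpha>)) n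
      + Gamma b * fps_nth (K * neg_binom_fps (b - of_real \<alpha> - 2)) n + fps_nth (W * R) n" for n
    by (simp only: fps_add_nth fps_mult_left_const_nth)
  moreover have "fps_nth (P * W) n = (\<Sum>j=0..n. fbdf2_weight \<alpha> (n - j) * of_nat j powr (b - 1))" for n
    by (simp add: fps_mult_nth P_def W_def) (simp add: mult.commute)
  ultimately show ?thesis
    using growth_add[OF growth_add[OF 3 2] 1] by (simp add: algebra_simps)
qed

lemma power_fun_0:
  assumes "Re b > 1"
  shows "power_fun b 0 = 0"
proof -
  have "((\<lambda>s. s powr (Re b - 1)) \<longlongrightarrow> 0) (at_right (0::real))"
    using assms by real_asymp
  then have "((\<lambda>s. of_real s powr (b - 1)) \<longlongrightarrow> 0) (at_right (0::real))"
    by (rule Lim_null_comparison[rotated])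
      (auto simp: eventually_at_filter norm_powr_real_powr intro!: always_eventually)
  then have "Lim (at_right (0::real)) (\<lambda>s. of_real s powr (b - 1)) = 0"
    by (intro tendsto_Lim) auto
  then show ?thesis by (simp add: power_fun_def)
qed

text \<open>Rescaling the nodes from \<open>j\<close> to \<open>j / n\<close> multiplies by
  \<open>n powr (\<alpha> + 1 - b)\<close>, which turns the exponents
  \<open>Re b - \<alpha> - 3\<close> and \<open>-1 - \<alpha>\<close> of the convolution error into
  \<open>-2\<close> and \<open>- Re b\<close>.\<close>

lemma fbdf2_error:
  fixes b :: complex
  assumes "0 < \<alpha>" "\<alpha> < 1" "b \<notin> \<int>\<^sub>\<le>\<^sub>0"
  shows "growth (max (-2) (- Re b))
    (\<lambda>n. conv_quadrature \<alpha> (fbdf2_weight \<alpha>) (1 / real n) (power_fun b) n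
       - Gamma b * rGamma (b - of_real \<alpha>))"
    (is "growth ?t ?E")
proof -
  define S where "S n = (\<Sum>j=0..n. fbdf2_weight \<alpha> (n - j) * of_nat j powr (b - 1))" for n
  define G where "G = Gamma b * rGamma (b - of_real \<alpha>)"
  define z where "z = of_real \<alpha> + 1 - b"
  have "growth (max (Re b - \<alpha> - 3) (-1 - \<alpha>) + Re z) (\<lambda>n. (S n - G * of_nat n powr (b - of_real \<alpha> - 1)) * of_nat n powr z)"
    unfolding S_def G_def using assms by (intro growth_mult growth_of_nat_powr fbdf2_power_convolution)
  then have 1: "growth ?t (\<lambda>n. (S n - G * of_nat n powr (b - of_real \<alpha> - 1)) * of_nat n powr z)"
    by (rule growth_mono) (auto simp: z_def)
  \<comment> \<open>The node \<open>0\<close> contributes a term of order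
    \<open>n powr (-1)\<close>, and only for \<open>Re b \<le> 1\<close>, when
    \<open>- Re b \<ge> -1\<close>.\<close>
  have 2: "growth ?t (\<lambda>n. power_fun b 0 * (fbdf2_weight \<alpha> n * of_nat n powr of_real \<alpha>))"
  proof (cases "Re b > 1")
    case True
    then show ?thesis by (simp add: power_fun_0 growth_finite_support)
  next
    case False
    have "growth (-1 - \<alpha> + Re (of_real \<alpha>)) (\<lambda>n. fbdf2_weight \<alpha> n * of_nat n powr of_real \<alpha>)"
      using assms by (intro growth_mult growth_of_nat_powr growth_fbdf2_weight)
    then show ?thesis
      using False by (intro growth_cmult) (auto elim: growth_mono)
  qed
  have "\<forall>\<^sub>F n in sequentially. (S n - G * of_nat n powr (b - of_real \<alpha> - 1)) * of_nat n powr z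
      + power_fun b 0 * (fbdf2_weight \<alpha> n * of_nat n powr of_real \<alpha>) = ?E n"
    using eventually_gt_at_top[of 0]
  proof eventually_elim
    case (elim n)
    \<comment> \<open>The node \<open>0\<close> is masked: \<open>power_fun\<close> takes the limit
      there, which is \<open>1\<close> for \<open>b = 1\<close>, whereas the right-hand side is
      \<open>0\<close>.\<close>
    have p: "(if j = 0 then 0 else power_fun b (real j * (1 / real n))) = of_nat j powr (b - 1) * of_nat n powr (1 - b)" for j
    proof (cases "j = 0")
      case False
      have "of_nat j powr (b - 1) = (of_real (real j * (1 / real n)) * of_nat n) powr (b - 1)"
        using elim by simp
      also have "\<dots> = of_real (real j * (1 / real n)) powr (b - 1) * of_nat n powr (b - 1)"
        by (intro powr_times_real) auto
      finally have "of_nat j powr (b - 1) * of_nat n powr (1 - b) =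
          of_real (real j * (1 / real n)) powr (b - 1) * (of_nat n powr (b - 1) * of_nat n powr (1 - b))"
        by (simp only: mult.assoc)
      also have "of_nat n powr (b - 1) * of_nat n powr (1 - b) = (1 :: complex)"
        using elim by (simp flip: powr_add)
      finally show ?thesis
        using False elim by (simp add: power_fun_def)
    qed auto
    have h: "of_real ((1 / real n) powr (-\<alpha>)) = of_nat n powr complex_of_real \<alpha>"
    proof -
      have "(1 / real n) powr (-\<alpha>) = real n powr \<alpha>"
        using elim by (simp add: powr_divide powr_minus_divide)
      then show ?thesis using powr_of_real[of "real n" \<alpha>] by simp
    qed
    have "(\<Sum>j=0..n. fbdf2_weight \<alpha> (n - j) * power_fun b (real j * (1 / real n))) =
        fbdf2_weight \<alpha> n * power_fun b 0 +
        (\<Sum>j=0..n. fbdf2_weight \<alpha> (n - j) * (if j = 0 then 0 else power_fun b (real j * (1 / real n))))"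
      by (simp add: sum.atLeast_Suc_atMost)
    also have "\<dots> = fbdf2_weight \<alpha> n * power_fun b 0 + S n * of_nat n powr (1 - b)"
      unfolding p by (simp add: S_def sum_distrib_right mult.assoc)
    finally have "conv_quadrature \<alpha> (fbdf2_weight \<alpha>) (1 / real n) (power_fun b) n =
        of_nat n powr of_real \<alpha> * (fbdf2_weight \<alpha> n * power_fun b 0 + S n * of_nat n powr (1 - b))"
      unfolding conv_quadrature_def h by simp
    moreover have "of_nat n powr of_real \<alpha> * of_nat n powr (1 - b) = of_nat n powr z"
      by (simp add: z_def algebra_simps flip: powr_add)
    moreover have "of_nat n powr (b - of_real \<alpha> - 1) * of_nat n powr z = (1 :: complex)"
      using elim by (simp add: z_def flip: powr_add)
    ultimately show ?case
      unfolding G_def[symmetric] by algebra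
  qed
  with growth_add[OF 1 2] show ?thesis
    by (subst (asm) growth_eventually_cong)
qed

theorem theorem5:
  fixes \<alpha> :: real
  assumes "0 < \<alpha>" and "\<alpha> < 1"
  shows "convergent_of_order \<alpha> (fbdf2_weight \<alpha>) 2"
  unfolding convergent_of_order_def
proof (intro allI impI)
  fix b :: complex
  assume b: "b \<notin> \<int>\<^sub>\<le>\<^sub>0"
  define E where "E n = conv_quadrature \<alpha> (fbdf2_weight \<alpha>) (1 / real n) (power_fun b) n
     - Gamma b * rGamma (b - of_real \<alpha>)" for n
  have E: "growth (max (-2) (- Re b)) E"
    unfolding E_def using assms b by (rule fbdf2_error)
  have bigo: "E \<in> O(\<lambda>n. of_real ((1 / real n) powr s))" if "growth (-s) E" for s
  proof -
    have "(\<lambda>n. norm (E n)) \<in> O(\<lambda>n. real n powr (-s))"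
      using that by (simp add: growth_iff_bigo)
    also have "(\<lambda>n. real n powr (-s)) \<in> O(\<lambda>n. (1 / real n) powr s)"
      by (intro bigoI[of _ 1] always_eventually) (simp add: powr_divide powr_minus_divide)
    finally show ?thesis
      by (simp add: landau_o.big.norm_iff flip: landau_o.big.norm_iff[of E])
  qed
  show "\<exists>u v. u \<in> O(\<lambda>n. of_real ((1 / real n) powr Re b)) \<and>
      v \<in> O(\<lambda>n. of_real ((1 / real n) ^ 2)) \<and>
      (\<forall>\<^sub>F n in sequentially. conv_quadrature \<alpha> (fbdf2_weight \<alpha>) (1 / real n) (power_fun b) n
         - Gamma b * rGamma (b - of_real \<alpha>) = u n + v n)"
  \<comment> \<open>One of the two orders dominates, so the whole error goes into \<open>u\<close>
    or into \<open>v\<close>, and the other is \<open>0\<close>.\<close>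
  proof (cases "Re b \<le> 2")
    case True
    then have "max (-2) (- Re b) = - Re b" by simp
    with E bigo have "E \<in> O(\<lambda>n. of_real ((1 / real n) powr Re b))" by simp
    then show ?thesis
      by (intro exI[of _ E] exI[of _ "\<lambda>_. 0"]) (simp add: E_def)
  next
    case False
    then have "max (-2) (- Re b) = -2" by simp
    with E bigo[of 2] have "E \<in> O(\<lambda>n. of_real ((1 / real n) powr 2))" by simp
    then have "E \<in> O(\<lambda>n. of_real ((1 / real n) ^ 2))" by simp
    then show ?thesis
      by (intro exI[of _ "\<lambda>_. 0"] exI[of _ E]) (simp add: E_def)
  qed
qed

end
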